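(* Up to similarity, there are exactly three irreducible $3$-dimensional linear subspaces of $\mathrm{M}_3(\mathbb{F}_2)$ with trivial spectrum: $$\mathcal{T}_1:=\left\{\begin{bmatrix}a&b&a\\ a&a&c\\ b+c&a&a\end{bmatrix}\mid(a,b,c)\in(\mathbb{F}_2)^3\right\},$$ $$\mathcal{T}_2:=\left\{\begin{bmatrix}a&b&a\\ a&a&c\\ 0&a&a\end{bmatrix}\mid(a,b,c)\in(\mathbb{F}_2)^3\right\}\quad\text{and}\quad \mathcal{T}_3:=\left\{\begin{bmatrix}a&b&a\\ a&0&c\\ 0&a&a\end{bmatrix}\mid(a,b,c)\in(\mathbb{F}_2)^3\right\}.$$
   Context: Two linear subspaces $\mathcal{V}_1,\mathcal{V}_2$ of $\mathrm{M}_n(\mathbb{K})$ are similar when $\mathcal{V}_2=P\mathcal{V}_1P^{-1}$ for some $P\in\mathrm{GL}_n(\mathbb{K})$. A linear subspace $\mathcal{V}$ of $\mathrm{M}_n(\mathbb{K})$ has a trivial spectrum when no matrix of $\mathcal{V}$ has an eigenvalue in $\mathbb{K}\setminus\{0\}$. A trivial spectrum subspace $\mathcal{V}$ of $\mathrm{M}_n(\mathbb{K})$ is irreducible when there is no proper non-zero linear subspace $F$ of $\mathbb{K}^n$ such that $\mathcal{V}X\subset F$ for all $X\in F$, where $\mathcal{V}X=\{MX\mid M\in\mathcal{V}\}$. *)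

theory Defs
  imports "HOL-Analysis.Analysis" "HOL-Library.Z2"
begin

text \<open>
  The library declares no scalar action of a general field on matrices
  (\<open>*\<^sub>R\<close> is only over the reals, and \<open>*s\<close> on matrices would take the scalar to be a row vector).
\<close>

definition mat_scale :: "'a::field \<Rightarrow> 'a ^ 'n ^ 'm \<Rightarrow> 'a ^ 'n ^ 'm"
  where "mat_scale c A = (\<chi> i j. c * A $ i $ j)"

global_interpretation matvs: vector_space "mat_scale :: 'a::field \<Rightarrow> 'a ^ 'n ^ 'm \<Rightarrow> 'a ^ 'n ^ 'm"
  by unfold_locales (simp_all add: mat_scale_def vec_eq_iff algebra_simps)

definition similar_subspaces :: "('a::field ^ 'n ^ 'n) set \<Rightarrow> ('a ^ 'n ^ 'n) set \<Rightarrow> bool"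
  where "similar_subspaces V1 V2 \<longleftrightarrow>
    (\<exists>P :: 'a ^ 'n ^ 'n. invertible P \<and> V2 = (\<lambda>M. P ** M ** matrix_inv P) ` V1)"

definition is_eigenvalue :: "'a::field ^ 'n ^ 'n \<Rightarrow> 'a \<Rightarrow> bool"
  where "is_eigenvalue M k \<longleftrightarrow> (\<exists>x. x \<noteq> 0 \<and> M *v x = k *s x)"

definition trivial_spectrum :: "('a::field ^ 'n ^ 'n) set \<Rightarrow> bool"
  where "trivial_spectrum V \<longleftrightarrow> \<not> (\<exists>M\<in>V. \<exists>k. k \<noteq> 0 \<and> is_eigenvalue M k)"

definition irreducible_subspace :: "('a::field ^ 'n ^ 'n) set \<Rightarrow> bool"
  where "irreducible_subspace V \<longleftrightarrow>
    \<not> (\<exists>F :: ('a ^ 'n) set. vec.subspace F \<and> F \<noteq> UNIV \<and> F \<noteq> {0} \<and>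
          (\<forall>X\<in>F. {M *v X |M. M \<in> V} \<subseteq> F))"

definition irreducible_trivial_spectrum_3dim :: "(bit ^ 3 ^ 3) set \<Rightarrow> bool"
  where "irreducible_trivial_spectrum_3dim V \<longleftrightarrow>
    matvs.subspace V \<and> matvs.dim V = 3 \<and> trivial_spectrum V \<and> irreducible_subspace V"

definition T1 :: "(bit ^ 3 ^ 3) set"
  where "T1 = {vector [vector [a, b, a],
                       vector [a, a, c],
                       vector [b + c, a, a]] |a b c. True}"

definition T2 :: "(bit ^ 3 ^ 3) set"
  where "T2 = {vector [vector [a, b, a],
                       vector [a, a, c],
                       vector [0, a, a]] |a b c. True}"

definition T3 :: "(bit ^ 3 ^ 3) set"
  where "T3 = {vector [vector [a, b, a],
                       vector [a, 0, c],
                       vector [0, a, a]] |a b c. True}"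

end

theory Submission
  imports Defs
begin

text \<open>
  Over the field with two elements the only nonzero scalar is 1, so a space \<open>V\<close> has trivial spectrum
  iff none of its matrices fixes a nonzero vector, that is, \<open>det (1 + M) = 1\<close> for all \<open>M\<close> in \<open>V\<close>. Since
  \<open>V\<close> has only eight elements, this is a small system of cubic equations in the entries of three
  generators, and it becomes rigid as soon as the basis of the vector space is adapted to \<open>V\<close>. The
  basis comes from the following counting argument.

  For \<open>x \<noteq> 0\<close> the map \<open>M \<mapsto> M x\<close> sends the eight elements of \<open>V\<close> into the eight vectors and misses \<open>x\<close>.
  So it is not injective, and by linearity some nonzero element of \<open>V\<close> kills \<open>x\<close>
  (\<open>killer_exists\<close>). There are two cases.

  Some \<open>x \<noteq> 0\<close> is killed by two different nonzero elements of \<open>V\<close> (\<open>two_killers\<close>). These act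
  on the quotient plane modulo \<open>x\<close>, again with trivial spectrum, and a trivial spectrum space of
  2 by 2 matrices has dimension at most one (\<open>planar_trivial_spectrum\<close>). Hence \<open>V\<close> contains a nonzero
  matrix \<open>E\<close> with range in the line of \<open>x\<close>. Take \<open>A\<close> in \<open>V\<close> with \<open>A x \<noteq> 0\<close>. Irreducibility prevents \<open>E\<close> from
  killing \<open>x + A x\<close>, so \<open>E\<close> is the matrix unit \<open>E12\<close> in a basis that starts with \<open>x, x + A x\<close>, and
  the determinant equations leave only \<open>T2\<close> and \<open>T3\<close> (\<open>T2_T3_normal_form\<close>).

  Otherwise every \<open>x \<noteq> 0\<close> has exactly one nonzero killer. Then no matrix of \<open>V\<close> has rank one
  (\<open>rank_one_impossible\<close>), so different vectors have different killers. There are seven nonzero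
  vectors and seven nonzero matrices, hence every matrix of \<open>V\<close> is a killer and \<open>V\<close> consists of singular
  matrices (\<open>all_singular\<close>). A nonzero matrix of trace zero in \<open>V\<close> is then nilpotent of rank two, and
  with a Jordan basis chosen to fit the plane \<open>V x\<close>, where \<open>x\<close> spans its kernel, the
  determinant equations have \<open>T1\<close> as their only solution (\<open>T1_normal_form\<close>, \<open>unique_killers_T1\<close>).

  Conversely, all three spaces contain the Jordan block \<open>E12 + E23\<close>, which moves every nonzero vector to
  the first basis vector after finitely many steps, and from there the generator with \<open>a = 1\<close>
  reaches the whole space; this is irreducibility (\<open>T_irreducible\<close>). They are
  pairwise dissimilar: \<open>T2\<close> and \<open>T3\<close> contain the square-zero matrix \<open>E12\<close> while \<open>T1\<close> has no nonzero
  square-zero matrix, and the trace vanishes on \<open>T3\<close> but not on \<open>T2\<close>.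
\<close>

section \<open>Vectors and matrices of size three over two elements\<close>

text \<open>
  By default, sums and products of bits are rewritten into Boolean connectives. Keeping the ring
  operations leaves determinants as polynomials.
\<close>

declare add_bit_eq_xor [simp del] mult_bit_eq_and [simp del]

definition vec3 :: "'a::zero \<Rightarrow> 'a \<Rightarrow> 'a \<Rightarrow> 'a ^ 3"
  where "vec3 a b c = vector [a, b, c]"

definition mat3 :: "'a::zero \<Rightarrow> 'a \<Rightarrow> 'a \<Rightarrow> 'a \<Rightarrow> 'a \<Rightarrow> 'a \<Rightarrow> 'a \<Rightarrow> 'a \<Rightarrow> 'a \<Rightarrow> 'a ^ 3 ^ 3"
  where "mat3 a b c d e f g h i = vector [vector [a, b, c], vector [d, e, f], vector [g, h, i]]"

lemma vec3_exhaust: obtains a b c where "x = vec3 a b c"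
proof
  show "x = vec3 (x$1) (x$2) (x$3)"
    by (simp add: vec3_def vec_eq_iff forall_3)
qed

lemma mat3_exhaust: obtains a b c d e f g h i where "M = mat3 a b c d e f g h i"
proof
  show "M = mat3 (M$1$1) (M$1$2) (M$1$3) (M$2$1) (M$2$2) (M$2$3) (M$3$1) (M$3$2) (M$3$3)"
    by (simp add: mat3_def vec_eq_iff forall_3)
qed

lemma vec3_eq_iff [simp]: "vec3 a b c = vec3 a' b' c' \<longleftrightarrow> a = a' \<and> b = b' \<and> c = c'"
  by (simp add: vec3_def vec_eq_iff forall_3)

lemma vec3_eq_0_iff [simp]:
  "vec3 a b c = 0 \<longleftrightarrow> a = 0 \<and> b = 0 \<and> c = 0" "0 = vec3 a b c \<longleftrightarrow> a = 0 \<and> b = 0 \<and> c = 0"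
  by (auto simp: vec3_def vec_eq_iff forall_3)

lemma mat3_eq_iff [simp]:
  "mat3 a b c d e f g h i = mat3 a' b' c' d' e' f' g' h' i' \<longleftrightarrow>
    a = a' \<and> b = b' \<and> c = c' \<and> d = d' \<and> e = e' \<and> f = f' \<and> g = g' \<and> h = h' \<and> i = i'"
  by (auto simp: mat3_def vec_eq_iff forall_3)

lemma mat3_eq_0_iff [simp]:
  "mat3 a b c d e f g h i = 0 \<longleftrightarrow>
    a = 0 \<and> b = 0 \<and> c = 0 \<and> d = 0 \<and> e = 0 \<and> f = 0 \<and> g = 0 \<and> h = 0 \<and> i = 0"
  "0 = mat3 a b c d e f g h i \<longleftrightarrow>
    a = 0 \<and> b = 0 \<and> c = 0 \<and> d = 0 \<and> e = 0 \<and> f = 0 \<and> g = 0 \<and> h = 0 \<and> i = 0"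
  by (auto simp: mat3_def vec_eq_iff forall_3)

lemma vec3_000: "vec3 0 0 0 = 0"
  by simp

lemma vec3_add [simp]:
  "vec3 a b c + vec3 a' b' c' = vec3 (a + a') (b + b') ((c::'a::monoid_add) + c')"
  by (simp add: vec3_def vec_eq_iff forall_3)

lemma mat3_add [simp]:
  "mat3 a b c d e f g h i + mat3 a' b' c' d' e' f' g' h' (i'::'a::monoid_add) =
    mat3 (a + a') (b + b') (c + c') (d + d') (e + e') (f + f') (g + g') (h + h') (i + i')"
  by (simp add: mat3_def vec_eq_iff forall_3)

lemma mat3_mult_vec3 [simp]:
  "mat3 a b c d e f g h i *v vec3 x y (z::'a::semiring_1) =
    vec3 (a * x + b * y + c * z) (d * x + e * y + f * z) (g * x + h * y + i * z)"
  by (simp add: vec3_def mat3_def vec_eq_iff forall_3 matrix_vector_mult_def sum_3)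

lemma vec3_mult_mat3 [simp]:
  "vec3 x y z v* mat3 a b c d e f g h (i::'a::comm_semiring_1) =
    vec3 (x * a + y * d + z * g) (x * b + y * e + z * h) (x * c + y * f + z * i)"
  by (simp add: vec3_def mat3_def vec_eq_iff forall_3 vector_matrix_mult_def sum_3 algebra_simps)

lemma mat3_mult_mat3 [simp]:
  "mat3 a b c d e f g h i ** mat3 a' b' c' d' e' f' g' h' (i'::'a::semiring_1) =
    mat3 (a * a' + b * d' + c * g') (a * b' + b * e' + c * h') (a * c' + b * f' + c * i')
         (d * a' + e * d' + f * g') (d * b' + e * e' + f * h') (d * c' + e * f' + f * i')
         (g * a' + h * d' + i * g') (g * b' + h * e' + i * h') (g * c' + h * f' + i * i')"
  by (simp add: mat3_def vec_eq_iff forall_3 matrix_matrix_mult_def sum_3)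

lemma mat_1_eq_mat3: "(mat 1 :: 'a::zero_neq_one ^ 3 ^ 3) = mat3 1 0 0 0 1 0 0 0 1"
  by (simp add: mat3_def mat_def vec_eq_iff forall_3)

lemma det_mat3:
  "det (mat3 a b c d e f g h (i::'a::comm_ring_1)) =
    a * e * i + b * f * g + c * d * h - a * f * h - b * d * i - c * e * g"
  by (simp add: mat3_def det_3)

lemma trace_mat3 [simp]: "trace (mat3 a b c d e f g h (i::'a::semiring_1)) = a + e + i"
  by (simp add: mat3_def trace_def sum_3)

instance bit :: finite
proof
  have "(UNIV :: bit set) = {0, 1}"
    by (auto intro: bit.exhaust)
  then show "finite (UNIV :: bit set)"
    by (metis finite.emptyI finite.insertI)
qed

lemma bit_eq_0_or_1: "(b::bit) = 0 \<or> b = 1"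
  by (cases b) simp_all

lemma card_bit [simp]: "CARD(bit) = 2"
proof -
  have "(UNIV :: bit set) = {0, 1}" by (auto intro: bit.exhaust)
  then show ?thesis by (metis card_2_iff zero_neq_one)
qed

lemma bit_double [simp]: "x + x = (0::bit)" "x + (x + y) = (y::bit)"
  by (cases x; cases y; simp)+

lemma bitvec_double [simp]: "x + x = (0 :: bit ^ 'n)" "x + (x + y) = (y :: bit ^ 'n)"
  by (simp_all add: vec_eq_iff)

lemma bitmat_double [simp]: "A + A = (0 :: bit ^ 'n ^ 'm)" "A + (A + B) = (B :: bit ^ 'n ^ 'm)"
  by (simp_all add: vec_eq_iff)

lemma bitmat_eq_iff_sum_0: "A = B \<longleftrightarrow> A + B = (0 :: bit ^ 'n ^ 'm)"
  by (metis add.right_neutral bitmat_double)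

lemma T1_eq: "T1 = {mat3 a b a a a c (b + c) a a | a b c. True}"
  and T2_eq: "T2 = {mat3 a b a a a c 0 a a | a b c. True}"
  and T3_eq: "T3 = {mat3 a b a a 0 c 0 a a | a b c. True}"
  by (simp_all add: T1_def T2_def T3_def mat3_def)

section \<open>Counting elements of subspaces\<close>

lemma mat_scale_bit [simp]: "mat_scale (0::bit) M = 0" "mat_scale (1::bit) M = M"
  by (simp_all add: mat_scale_def vec_eq_iff)

text \<open>
  Adjoining an independent generator \<open>b\<close> to \<open>B\<close> adds the coset \<open>b + span B\<close>, which is disjoint from
  \<open>span B\<close>, so the cardinality doubles.
\<close>

lemma card_span_bit:
  fixes B :: "(bit ^ 'n ^ 'm) set"
  assumes "matvs.independent B"
  shows "card (matvs.span B) = 2 ^ card B"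
proof -
  have "finite B" by simp
  then show ?thesis using assms
  proof (induction B rule: finite_induct)
    case (insert b B)
    have ind: "matvs.independent B" and b: "b \<notin> matvs.span B"
      using insert.prems insert.hyps by (simp_all add: matvs.independent_insert)
    have span: "matvs.span (insert b B) = matvs.span B \<union> (+) b ` matvs.span B"
    proof -
      have "x \<in> matvs.span (insert b B) \<longleftrightarrow> x \<in> matvs.span B \<or> b + x \<in> matvs.span B" for x
      proof -
        have "x \<in> matvs.span (insert b B) \<longleftrightarrow> (\<exists>k. x - mat_scale k b \<in> matvs.span B)"
          by (auto simp: matvs.span_insert)
        also have "\<dots> \<longleftrightarrow> x - mat_scale 0 b \<in> matvs.span B \<or> x - mat_scale 1 b \<in> matvs.span B"
          by (metis bit_not_zero_iff)
        also have "x - mat_scale 1 b = b + x"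
          by (simp add: vec_eq_iff add.commute)
        finally show ?thesis by simp
      qed
      moreover have "x \<in> (+) b ` matvs.span B \<longleftrightarrow> b + x \<in> matvs.span B" for x
        using image_eqI[of x "(+) b" "b + x"] by auto
      ultimately show ?thesis by blast
    qed
    have "matvs.span B \<inter> (+) b ` matvs.span B = {}"
    proof -
      have "b \<in> matvs.span B" if "x \<in> matvs.span B" "b + x \<in> matvs.span B" for x
        using matvs.span_diff[OF that(2) that(1)] by simp
      then show ?thesis using b by auto
    qed
    then have "card (matvs.span (insert b B)) = card (matvs.span B) + card ((+) b ` matvs.span B)"
      unfolding span by (intro card_Un_disjoint) auto
    also have "card ((+) b ` matvs.span B) = card (matvs.span B)"
      by (intro card_image) (simp add: inj_on_def)
    finally show ?case using insert ind by simp
  qed simp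
qed

lemma card_subspace_bit:
  fixes V :: "(bit ^ 'n ^ 'm) set"
  assumes "matvs.subspace V"
  shows "card V = 2 ^ matvs.dim V"
proof -
  obtain B where "B \<subseteq> V" "matvs.independent B" "V \<subseteq> matvs.span B" "card B = matvs.dim V"
    using matvs.basis_exists by blast
  then show ?thesis
    using card_span_bit matvs.span_minimal[OF _ assms] by (metis subset_antisym)
qed

section \<open>The hypotheses as finite conditions\<close>

lemma subspace_bit_iff:
  "matvs.subspace V \<longleftrightarrow> 0 \<in> V \<and> (\<forall>A\<in>V. \<forall>B\<in>V. A + B \<in> (V :: (bit ^ 'n ^ 'm) set))"
proof -
  have "mat_scale c A \<in> V" if "0 \<in> V" "A \<in> V" for c A
    using that by (cases c) auto
  then show ?thesis by (auto simp: matvs.subspace_def)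
qed

lemma vec_subspace_bit_iff:
  "vec.subspace F \<longleftrightarrow> 0 \<in> F \<and> (\<forall>x\<in>F. \<forall>y\<in>F. x + y \<in> (F :: (bit ^ 'n) set))"
proof -
  have "c *s x \<in> F" if "0 \<in> F" "x \<in> F" for c x
    using that by (cases c) auto
  then show ?thesis by (auto simp: vec.subspace_def)
qed

lemma trivial_spectrum_bit_iff:
  "trivial_spectrum (V :: (bit ^ 'n ^ 'n) set) \<longleftrightarrow> (\<forall>M\<in>V. \<forall>x. M *v x = x \<longrightarrow> x = 0)"
  by (auto simp: trivial_spectrum_def is_eigenvalue_def)

lemma no_fixed_vector_iff_det:
  fixes M :: "bit ^ 'n ^ 'n"
  shows "(\<forall>x. M *v x = x \<longrightarrow> x = 0) \<longleftrightarrow> det (mat 1 + M) = 1"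
proof -
  have "(mat 1 + M) *v x = 0 \<longleftrightarrow> M *v x = x" for x
    by (simp add: matrix_vector_mult_add_rdistrib) (metis add.right_neutral bitvec_double)
  then have "(\<forall>x. M *v x = x \<longrightarrow> x = 0) \<longleftrightarrow> invertible (mat 1 + M)"
    unfolding invertible_left_inverse matrix_left_invertible_ker by simp
  then show ?thesis by (simp add: invertible_det_nz)
qed

text \<open>
  An elementary form of the hypotheses that is transported easily along similarity. The last two clauses
  say that no line and no plane is invariant: an invariant line \<open>{0, x}\<close> is killed by \<open>V\<close>, because \<open>x\<close>
  cannot be fixed, and the kernel of a row vector \<open>r\<close> is invariant under \<open>M\<close> iff \<open>r M\<close> is \<open>0\<close> or \<open>r\<close>.
\<close>

definition admissible :: "(bit ^ 3 ^ 3) set \<Rightarrow> bool"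
  where "admissible V \<longleftrightarrow>
    (\<forall>A\<in>V. \<forall>B\<in>V. A + B \<in> V) \<and> card V = 8 \<and>
    (\<forall>M\<in>V. \<forall>x. M *v x = x \<longrightarrow> x = 0) \<and>
    (\<forall>x. x \<noteq> 0 \<longrightarrow> (\<exists>M\<in>V. M *v x \<noteq> 0)) \<and>
    (\<forall>r. r \<noteq> 0 \<longrightarrow> (\<exists>M\<in>V. r v* M \<noteq> 0 \<and> r v* M \<noteq> r))"

lemma irreducible_trivial_spectrum_3dim_imp_admissible:
  assumes "irreducible_trivial_spectrum_3dim V"
  shows "admissible V"
proof -
  have sub: "matvs.subspace V" and dim: "matvs.dim V = 3" and ts: "trivial_spectrum V"
    and irr: "irreducible_subspace V"
    using assms by (auto simp: irreducible_trivial_spectrum_3dim_def)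
  have card: "card V = 8"
    using card_subspace_bit[OF sub] dim by simp
  have no_fixed: "x = 0" if "M \<in> V" "M *v x = x" for M x
    using ts that by (auto simp: trivial_spectrum_bit_iff)
  have "\<exists>M\<in>V. M *v x \<noteq> 0" if x: "x \<noteq> 0" for x
  proof (rule ccontr)
    assume "\<not> ?thesis"
    then have kill: "M *v x = 0" if "M \<in> V" for M using that by blast
    let ?F = "{0, x}"
    have "vec.subspace ?F" by (auto simp: vec_subspace_bit_iff)
    moreover have "?F \<noteq> UNIV"
    proof
      assume "?F = UNIV"
      then have "vec3 1 0 0 \<in> ?F" "vec3 0 1 0 \<in> ?F" by blast+
      then show False by auto
    qed
    moreover have "?F \<noteq> {0}" using x by auto
    moreover have "\<forall>X\<in>?F. {M *v X |M. M \<in> V} \<subseteq> ?F" using kill by auto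
    ultimately show False using irr unfolding irreducible_subspace_def by blast
  qed
  moreover have "\<exists>M\<in>V. r v* M \<noteq> 0 \<and> r v* M \<noteq> r" if r: "r \<noteq> 0" for r
  proof (rule ccontr)
    assume "\<not> ?thesis"
    then have rM: "r v* M = 0 \<or> r v* M = r" if "M \<in> V" for M using that by blast
    define dot where "dot s x = s$1 * x$1 + s$2 * x$2 + s$3 * x$3" for s x :: "bit ^ 3"
    have dot_vec3: "dot (vec3 a b c) (vec3 x y z) = a * x + b * y + c * z" for a b c x y z
      by (simp add: dot_def vec3_def)
    have dot_add: "dot r (x + y) = dot r x + dot r y" for x y
      by (simp add: dot_def algebra_simps)
    have dot_mult: "dot r (M *v x) = dot (r v* M) x" for M x
      by (simp add: dot_def vector_matrix_mult_def matrix_vector_mult_def sum_3 algebra_simps)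
    let ?F = "{x. dot r x = 0}"
    obtain a b c where abc: "r = vec3 a b c" by (rule vec3_exhaust)
    have "vec.subspace ?F"
      by (auto simp: vec_subspace_bit_iff dot_add) (simp add: dot_def)
    moreover have "?F \<noteq> UNIV"
    proof
      assume "?F = UNIV"
      then have "vec3 1 0 0 \<in> ?F" "vec3 0 1 0 \<in> ?F" "vec3 0 0 1 \<in> ?F" by blast+
      then show False using r by (auto simp: abc dot_vec3)
    qed
    moreover have "?F \<noteq> {0}"
    proof
      assume F: "?F = {0}"
      \<comment> \<open>The cross products of \<open>r\<close> with the basis vectors lie in the kernel of \<open>r\<close>.\<close>
      have "vec3 b a 0 \<in> ?F" "vec3 0 c b \<in> ?F" "vec3 c 0 a \<in> ?F"
        by (simp_all add: abc dot_vec3 mult.commute)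
      then show False unfolding F using r by (auto simp: abc)
    qed
    moreover have "\<forall>X\<in>?F. {M *v X |M. M \<in> V} \<subseteq> ?F"
    proof clarify
      fix X M assume "dot r X = 0" "M \<in> V"
      then show "dot r (M *v X) = 0"
        using rM[of M] by (auto simp: dot_mult) (simp add: dot_def)
    qed
    ultimately show False using irr unfolding irreducible_subspace_def by blast
  qed
  ultimately show ?thesis
    using sub card no_fixed by (auto simp: admissible_def subspace_bit_iff)
qed

lemma
  assumes "admissible V"
  shows admissible_add: "A \<in> V \<Longrightarrow> B \<in> V \<Longrightarrow> A + B \<in> V"
    and admissible_card: "card V = 8"
    and admissible_no_fixed: "M \<in> V \<Longrightarrow> M *v x = x \<Longrightarrow> x = 0"
    and admissible_not_killed: "x \<noteq> 0 \<Longrightarrow> \<exists>M\<in>V. M *v x \<noteq> 0"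
    and admissible_row: "r \<noteq> 0 \<Longrightarrow> \<exists>M\<in>V. r v* M \<noteq> 0 \<and> r v* M \<noteq> r"
  using assms by (simp_all add: admissible_def)

section \<open>Change of basis\<close>

definition conj_mat :: "bit ^ 3 ^ 3 \<Rightarrow> bit ^ 3 ^ 3 \<Rightarrow> bit ^ 3 ^ 3"
  where "conj_mat P M = P ** M ** matrix_inv P"

lemma matrix_inv_cancel:
  assumes "invertible (P :: 'a::field ^ 'n ^ 'n)"
  shows "P ** matrix_inv P = mat 1" "matrix_inv P ** P = mat 1"
proof -
  have "\<exists>Q. P ** Q = mat 1 \<and> Q ** P = mat 1"
    using assms by (auto simp: invertible_def)
  then have "P ** matrix_inv P = mat 1 \<and> matrix_inv P ** P = mat 1"
    unfolding matrix_inv_def by (rule someI_ex)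
  then show "P ** matrix_inv P = mat 1" "matrix_inv P ** P = mat 1" by auto
qed

lemma matrix_inv_eqI:
  assumes "(A :: 'a::field ^ 'n ^ 'n) ** B = mat 1"
  shows "matrix_inv A = B"
proof -
  have "invertible A"
    using assms by (auto simp: invertible_right_inverse)
  have "matrix_inv A = matrix_inv A ** (A ** B)"
    using assms by simp
  also have "\<dots> = B"
    using matrix_inv_cancel(2)[OF \<open>invertible A\<close>] by (simp add: matrix_mul_assoc)
  finally show ?thesis .
qed

lemma conj_mat_mult_vec:
  assumes "invertible P"
  shows "conj_mat P M *v (P *v x) = P *v (M *v x)"
proof -
  have "conj_mat P M ** P = P ** M"
    using matrix_inv_cancel[OF assms] by (simp add: conj_mat_def flip: matrix_mul_assoc)
  then show ?thesis by (simp add: matrix_vector_mul_assoc)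
qed

lemma conj_mat_mem: "M \<in> V \<Longrightarrow> conj_mat P M \<in> conj_mat P ` V"
  by simp

lemma conj_mat_add: "conj_mat P (A + B) = conj_mat P A + conj_mat P B"
  by (simp add: conj_mat_def matrix_add_ldistrib matrix_matrix_mult_def vec_eq_iff
      sum.distrib distrib_left distrib_right)

lemma conj_mat_mult:
  assumes "invertible P"
  shows "conj_mat P (A ** B) = conj_mat P A ** conj_mat P B"
proof -
  have "conj_mat P A ** conj_mat P B = P ** A ** (matrix_inv P ** P) ** B ** matrix_inv P"
    by (simp only: conj_mat_def matrix_mul_assoc)
  then show ?thesis
    using matrix_inv_cancel[OF assms] by (simp add: conj_mat_def matrix_mul_assoc)
qed

lemma conj_mat_inv:
  assumes "invertible P"
  shows "matrix_inv P ** conj_mat P M ** P = M"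
proof -
  have "matrix_inv P ** conj_mat P M ** P = (matrix_inv P ** P) ** M ** (matrix_inv P ** P)"
    by (simp only: conj_mat_def matrix_mul_assoc)
  then show ?thesis using matrix_inv_cancel[OF assms] by simp
qed

lemma conj_mat_eq_0_iff:
  assumes "invertible P"
  shows "conj_mat P M = 0 \<longleftrightarrow> M = 0"
proof
  assume "conj_mat P M = 0"
  then show "M = 0" using conj_mat_inv[OF assms, of M] by simp
qed (simp add: conj_mat_def)

lemma inj_conj_mat:
  assumes "invertible P"
  shows "inj (conj_mat P)"
  by (metis conj_mat_inv[OF assms] injI)

lemma trace_conj_mat:
  assumes "invertible P"
  shows "trace (conj_mat P M) = trace M"
proof -
  have "trace (conj_mat P M) = trace (matrix_inv P ** (P ** M))"
    unfolding conj_mat_def by (rule trace_mul_sym)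
  then show ?thesis using matrix_inv_cancel[OF assms] by (simp add: matrix_mul_assoc)
qed

lemma similar_subspaces_iff_conj_mat:
  "similar_subspaces V1 V2 \<longleftrightarrow> (\<exists>P. invertible P \<and> V2 = conj_mat P ` V1)"
  by (simp add: similar_subspaces_def conj_mat_def)

lemma conj_mat_conj_mat:
  assumes "invertible P" "invertible Q"
  shows "conj_mat Q (conj_mat P M) = conj_mat (Q ** P) M"
proof -
  have "(Q ** P) ** (matrix_inv P ** matrix_inv Q) = Q ** (P ** matrix_inv P) ** matrix_inv Q"
    by (simp only: matrix_mul_assoc)
  also have "\<dots> = mat 1"
    using matrix_inv_cancel[OF assms(1)] matrix_inv_cancel[OF assms(2)] by simp
  finally have "matrix_inv (Q ** P) = matrix_inv P ** matrix_inv Q"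
    by (rule matrix_inv_eqI)
  then show ?thesis by (simp add: conj_mat_def matrix_mul_assoc)
qed

lemma similar_subspaces_trans:
  assumes "similar_subspaces V1 V2" "similar_subspaces V2 (V3 :: (bit ^ 3 ^ 3) set)"
  shows "similar_subspaces V1 V3"
proof -
  obtain P Q where "invertible P" "V2 = conj_mat P ` V1" "invertible Q" "V3 = conj_mat Q ` V2"
    using assms unfolding similar_subspaces_iff_conj_mat by blast
  then have "invertible (Q ** P)" "V3 = conj_mat (Q ** P) ` V1"
    by (simp_all add: image_image conj_mat_conj_mat invertible_mult)
  then show ?thesis unfolding similar_subspaces_iff_conj_mat by blast
qed

lemma admissible_conj_mat:
  assumes P: "invertible P" and V: "admissible V"
  shows "admissible (conj_mat P ` V)"
proof -
  let ?Q = "matrix_inv P"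
  note canc = matrix_inv_cancel[OF P]
  have PQ: "P *v (?Q *v x) = x" "?Q *v (P *v x) = x" for x
    using canc by (simp_all add: matrix_vector_mul_assoc)
  have QP': "(r v* P) v* ?Q = r" "(r v* ?Q) v* P = r" for r
    using canc by (simp_all add: vector_matrix_mul_assoc)
  have conj: "conj_mat P M *v x = P *v (M *v (?Q *v x))" for M x
    using conj_mat_mult_vec[OF P, of M "?Q *v x"] by (simp add: PQ)
  have conj': "(r v* conj_mat P M) = ((r v* P) v* M) v* ?Q" for M r
    by (simp add: conj_mat_def vector_matrix_mul_assoc matrix_mul_assoc)
  have zero: "P *v x = 0 \<longleftrightarrow> x = 0" "?Q *v x = 0 \<longleftrightarrow> x = 0" for x
    using PQ by (metis matrix_vector_mult_0_right)+
  have zero': "r v* P = 0 \<longleftrightarrow> r = 0" "r v* ?Q = 0 \<longleftrightarrow> r = 0" for r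
    using QP' by (metis vector_matrix_mult_0)+
  show ?thesis
    unfolding admissible_def
  proof (intro conjI ballI allI impI)
    show "card (conj_mat P ` V) = 8"
      using admissible_card[OF V] card_image[OF inj_on_subset[OF inj_conj_mat[OF P]], of V] by simp
  next
    fix A B assume "A \<in> conj_mat P ` V" "B \<in> conj_mat P ` V"
    then show "A + B \<in> conj_mat P ` V"
      using admissible_add[OF V] by (auto simp flip: conj_mat_add)
  next
    fix N x assume "N \<in> conj_mat P ` V" and fixed: "N *v x = x"
    then obtain M where M: "M \<in> V" "N = conj_mat P M" by blast
    have "M *v (?Q *v x) = ?Q *v (N *v x)"
      by (simp add: M(2) conj PQ)
    then have "?Q *v x = 0"
      by (intro admissible_no_fixed[OF V M(1)]) (simp only: fixed)
    then show "x = 0"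
      by (simp add: zero)
  next
    fix x :: "bit ^ 3" assume "x \<noteq> 0"
    then obtain M where "M \<in> V" "M *v (?Q *v x) \<noteq> 0"
      using admissible_not_killed[OF V, of "?Q *v x"] zero by auto
    then show "\<exists>N\<in>conj_mat P ` V. N *v x \<noteq> 0"
      using zero by (auto simp: conj)
  next
    fix r :: "bit ^ 3" assume "r \<noteq> 0"
    then obtain M where M: "M \<in> V" "(r v* P) v* M \<noteq> 0" "(r v* P) v* M \<noteq> r v* P"
      using admissible_row[OF V, of "r v* P"] zero' by auto
    have "r v* conj_mat P M \<noteq> r"
    proof
      assume "r v* conj_mat P M = r"
      then have "(((r v* P) v* M) v* ?Q) v* P = r v* P" by (simp only: conj')
      then show False using M(3) by (simp only: QP')
    qed
    moreover have "r v* conj_mat P M \<noteq> 0"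
      using M(2) zero' by (simp add: conj')
    ultimately show "\<exists>N\<in>conj_mat P ` V. r v* N \<noteq> 0 \<and> r v* N \<noteq> r"
      using M(1) by blast
  qed
qed

text \<open>
  In characteristic two, \<open>x, y, z\<close> are independent iff all seven of their nontrivial sums are nonzero;
  the assumptions express this by comparing each vector with the sums of the earlier ones.
\<close>

lemma change_of_basis:
  fixes x y z :: "bit ^ 3"
  assumes "x \<noteq> 0" "y \<noteq> 0" "z \<noteq> 0" "y \<noteq> x" "z \<noteq> x" "z \<noteq> y" "z \<noteq> x + y"
  obtains P where "invertible P" "P *v x = vec3 1 0 0" "P *v y = vec3 0 1 0" "P *v z = vec3 0 0 1"
proof -
  obtain x1 x2 x3 y1 y2 y3 z1 z2 z3 where
    eqs: "x = vec3 x1 x2 x3" "y = vec3 y1 y2 y3" "z = vec3 z1 z2 z3"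
    by (metis vec3_exhaust)
  define Q where "Q = mat3 x1 y1 z1 x2 y2 z2 x3 y3 z3"
  have cols: "Q *v vec3 1 0 0 = x" "Q *v vec3 0 1 0 = y" "Q *v vec3 0 0 1 = z"
    by (simp_all add: Q_def eqs)
  have "v = 0" if "Q *v v = 0" for v
  proof -
    obtain a b c where v: "v = vec3 a b c" by (rule vec3_exhaust)
    have "v = 0 \<or> Q *v v \<in> {x, y, z, x + y, x + z, y + z, x + y + z}"
      unfolding v Q_def eqs by (cases a; cases b; cases c; simp)
    moreover have "0 \<notin> {x, y, z, x + y, x + z, y + z, x + y + z}"
      using assms by (metis bitvec_double(2) add.right_neutral add.commute insert_iff empty_iff)
    ultimately show "v = 0" using that by auto
  qed
  then have Q: "invertible Q"
    unfolding invertible_left_inverse matrix_left_invertible_ker by blast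
  show thesis
  proof
    show "invertible (matrix_inv Q)"
      using matrix_inv_cancel[OF Q] unfolding invertible_def by blast
    show "matrix_inv Q *v x = vec3 1 0 0" "matrix_inv Q *v y = vec3 0 1 0"
      "matrix_inv Q *v z = vec3 0 0 1"
      using matrix_inv_cancel[OF Q] by (simp_all add: matrix_vector_mul_assoc flip: cols)
  qed
qed

lemma basis_expansion:
  fixes x y z v :: "bit ^ 3"
  assumes "x \<noteq> 0" "y \<noteq> 0" "z \<noteq> 0" "y \<noteq> x" "z \<noteq> x" "z \<noteq> y" "z \<noteq> x + y"
  obtains a b c where "v = a *s x + b *s y + c *s z"
proof -
  obtain P where P: "invertible P" "P *v x = vec3 1 0 0" "P *v y = vec3 0 1 0" "P *v z = vec3 0 0 1"
    by (rule change_of_basis[OF assms])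
  obtain a b c where abc: "P *v v = vec3 a b c" by (rule vec3_exhaust)
  have smult: "k *s vec3 p q r = vec3 (k * p) (k * q) (k * r)" for k p q r :: bit
    by (cases k) simp_all
  have "P *v (a *s x + b *s y + c *s z) = P *v v"
    by (simp add: matrix_vector_right_distrib vector_scalar_commute P abc smult)
  then have "matrix_inv P *v (P *v (a *s x + b *s y + c *s z)) = matrix_inv P *v (P *v v)"
    by (simp only:)
  then show thesis
    using that[of a b c] matrix_inv_cancel[OF P(1)] by (simp add: matrix_vector_mul_assoc)
qed

lemma exists_outside_plane:
  obtains z :: "bit ^ 3" where "z \<notin> {0, x, y, x + y}"
proof -
  have "card {0, x, y, x + y} \<le> 4"
    by (auto simp: card_insert_if)
  moreover have "CARD(bit ^ 3) = 8" by simp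
  ultimately have "{0, x, y, x + y} \<noteq> UNIV" by auto
  then show thesis using that by blast
qed

section \<open>Determinant equations and normal forms\<close>

lemma set_of_three_bits:
  "{f a b c | (a :: bit) (b :: bit) (c :: bit). True} =
    {f 0 0 0, f 0 1 0, f 0 0 1, f 0 1 1, f 1 0 0, f 1 1 0, f 1 0 1, f 1 1 1}"
  (is "?L = ?R")
proof (intro set_eqI iffI)
  fix x assume "x \<in> ?L"
  then obtain a b c where "x = f a b c" by blast
  then show "x \<in> ?R" by - (cases a; cases b; cases c; simp)
qed blast

text \<open>
  Three independent elements of \<open>V\<close> have eight different sums, which is all of \<open>V\<close>.
\<close>

lemma admissible_eq_span:
  assumes V: "admissible V" and "A \<in> V" "B \<in> V" "C \<in> V"
    and AB: "A \<noteq> 0" "B \<noteq> 0" "B \<noteq> A" and C: "C \<notin> {0, A, B, A + B}"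
  shows "V = {0, A, B, A + B, C, C + A, C + B, C + (A + B)}"
proof -
  define G where "G = {0, A, B, A + B}"
  have zero: "0 \<in> V"
    using admissible_add[OF V \<open>A \<in> V\<close> \<open>A \<in> V\<close>] by simp
  have sub: "G \<union> (+) C ` G \<subseteq> V"
    using zero assms(2-4) admissible_add[OF V] by (auto simp: G_def)
  have "A + B \<noteq> 0"
    using AB(3) by (metis bitmat_eq_iff_sum_0)
  then have "card G = 4" using AB by (simp add: G_def)
  moreover have "card ((+) C ` G) = card G"
    by (intro card_image) (simp add: inj_on_def)
  moreover have "G \<inter> (+) C ` G = {}"
  proof -
    have sums: "(A + B) + A = B" "B + (A + B) = A" "(A + B) + B = A"
      by (simp_all add: vec_eq_iff add.commute add.left_commute)
    have closed: "\<forall>g\<in>G. \<forall>h\<in>G. g + h \<in> G"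
      by (simp only: G_def ball_simps sums bitmat_double add_0_left add_0_right insert_iff simp_thms
          add.commute[of B A])
    have "C \<in> G" if "g \<in> G" "C + g \<in> G" for g
    proof -
      have "C = (C + g) + g" by (simp add: add.assoc)
      then show ?thesis using closed that by metis
    qed
    then show ?thesis using C unfolding G_def[symmetric] by blast
  qed
  ultimately have "card (G \<union> (+) C ` G) = 8"
    by (subst card_Un_disjoint) simp_all
  then have "G \<union> (+) C ` G = V"
    using sub admissible_card[OF V] by (intro card_subset_eq) auto
  then show ?thesis by (auto simp: G_def)
qed

lemma admissible_det:
  assumes "admissible V" "M \<in> V"
  shows "det (mat 1 + M) = 1"
  using assms no_fixed_vector_iff_det admissible_no_fixed by blast

text \<open>
  This equation is affine in each entry. When both \<open>M\<close> and \<open>M + E\<close> lie in \<open>V\<close> for a matrix unit \<open>E\<close>,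
  adding their two equations shows that the cofactor of \<open>1 + M\<close> at the position of \<open>E\<close> vanishes. This
  is how the normal forms below become rigid.
\<close>

lemma admissible_det_mat3:
  assumes "admissible V" "mat3 a b c d e f g h i \<in> V"
  shows "(1 + a) * ((1 + e) * (1 + i) + f * h) + b * (d * (1 + i) + f * g) + c * (d * h + (1 + e) * g) = 1"
  using admissible_det[OF assms]
  by (simp add: mat_1_eq_mat3 det_mat3 algebra_simps)

lemma first_column:
  assumes "M *v vec3 1 0 0 = vec3 a d (g::bit)"
  obtains b c e f h i where "M = mat3 a b c d e f g h i"
proof (rule mat3_exhaust[of M])
  fix a' b c d' e f g' h i
  assume "M = mat3 a' b c d' e f g' h i"
  with assms show thesis using that by simp
qed

lemma columns_eqI:
  assumes "M *v vec3 1 0 0 = vec3 a d g" "M *v vec3 0 1 0 = vec3 b e h" "M *v vec3 0 0 1 = vec3 c f (i::bit)"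
  shows "M = mat3 a b c d e f g h i"
  using assms by (cases M rule: mat3_exhaust) simp

text \<open>
  Adding \<open>E\<close> to \<open>A\<close> and to \<open>A + C\<close> gives the vanishing of cofactors. Together with the equations
  for \<open>A\<close>, \<open>C\<close> and \<open>A + C\<close> this fixes every entry of \<open>A\<close> and \<open>C\<close> except the middle entry of \<open>A\<close> and those
  that can be altered by adding \<open>E\<close> or \<open>C\<close>. The middle entry decides between \<open>T2\<close> and \<open>T3\<close>.
\<close>

lemma T2_T3_normal_form:
  assumes V: "admissible V" and E: "mat3 0 1 0 0 0 0 0 0 0 \<in> V" (is "?E \<in> V")
    and C: "C \<in> V" "C \<noteq> 0" "C \<noteq> mat3 0 1 0 0 0 0 0 0 0" "C *v vec3 1 0 0 = vec3 0 0 0"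
    and A: "A \<in> V" "A *v vec3 1 0 0 = vec3 1 1 0"
  shows "V = T2 \<or> V = T3"
proof -
  obtain c12 c13 c22 c23 c32 c33 where C_eq: "C = mat3 0 c12 c13 0 c22 c23 0 c32 c33"
    using first_column[OF C(4)] by metis
  obtain a12 a13 a22 a23 a32 a33 where A_eq: "A = mat3 1 a12 a13 1 a22 a23 0 a32 a33"
    using first_column[OF A(2)] by metis
  note det = admissible_det_mat3[OF V]
  have a: "a33 = 1 \<and> a13 = 1 \<and> a32 = 1"
    using det[OF A(1)[unfolded A_eq]] det[OF admissible_add[OF V A(1) E, unfolded A_eq mat3_add]]
    by - (cases a12; cases a33; cases a13; cases a32; simp)
  have ca: "c33 = 0 \<and> c13 = 0 \<and> c32 = 0"
  proof -
    have AC: "A + C \<in> V" using admissible_add[OF V A(1) C(1)] .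
    show ?thesis
      using det[OF AC[unfolded A_eq C_eq mat3_add]] a
        det[OF admissible_add[OF V AC E, unfolded A_eq C_eq mat3_add]]
      by - (cases "a12 + c12"; cases c33; cases c13; cases c32; simp)
  qed
  have "c22 = 0"
    using det[OF C(1)[unfolded C_eq]] ca by simp
  moreover from this have "c23 = 1"
    using C(2,3) ca by (auto simp: C_eq)
  ultimately have C_eq': "C = mat3 0 c12 0 0 0 1 0 0 0"
    using ca C_eq by simp
  define D where "D = mat3 0 0 0 0 0 (1::bit) 0 0 0"
  define J where "J = mat3 1 0 1 1 a22 0 0 1 1"
  have D: "D \<in> V"
    using C(1) admissible_add[OF V C(1) E] by - (cases c12; simp add: C_eq' D_def)
  have "mat3 1 0 1 1 a22 a23 0 1 1 \<in> V"
    using A(1) admissible_add[OF V A(1) E] a by - (cases a12; simp add: A_eq)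
  from this and admissible_add[OF V this D] have J: "J \<in> V"
    by - (cases a23; simp add: J_def D_def)
  have "V = {0, ?E, D, ?E + D, J, J + ?E, J + D, J + (?E + D)}"
    by (rule admissible_eq_span[OF V E D J]) (simp_all add: D_def J_def)
  moreover have "(0 :: bit ^ 3 ^ 3) = mat3 0 0 0 0 0 0 0 0 0" by simp
  ultimately have V_eq: "V = {mat3 0 0 0 0 0 0 0 0 0, ?E, D, ?E + D, J, J + ?E, J + D, J + (?E + D)}"
    by (simp only:)
  show ?thesis
  proof (cases "a22 = 0")
    case True
    then have "V = T3"
      unfolding V_eq T3_eq set_of_three_bits by (simp add: D_def J_def)
    then show ?thesis ..
  next
    case False
    then have "V = T2"
      unfolding V_eq T2_eq set_of_three_bits by (simp add: D_def J_def)
    then show ?thesis ..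
  qed
qed

text \<open>
  The conclusion makes \<open>A\<close> a second killer, besides \<open>E13\<close>, of the second basis vector. If \<open>A\<close> did not
  kill it, the equations for \<open>B\<close> and \<open>A + B\<close> would contradict each other.
\<close>

lemma rank_one_normal_form:
  assumes V: "admissible V" and C: "mat3 0 0 1 0 0 0 0 0 0 \<in> V"
    and A: "A \<in> V" "A *v vec3 1 0 0 = vec3 0 1 0"
    and B: "B \<in> V" "B *v vec3 1 0 0 = vec3 0 0 1"
  shows "A *v vec3 0 1 0 = 0"
proof -
  obtain a12 a13 a22 a23 a32 a33 where A_eq: "A = mat3 0 a12 a13 1 a22 a23 0 a32 a33"
    using first_column[OF A(2)] by metis
  obtain b12 b13 b22 b23 b32 b33 where B_eq: "B = mat3 0 b12 b13 0 b22 b23 1 b32 b33"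
    using first_column[OF B(2)] by metis
  note det = admissible_det_mat3[OF V]
  have AB: "A + B \<in> V" using admissible_add[OF V A(1) B(1)] .
  note dA = det[OF A(1)[unfolded A_eq]] and dB = det[OF B(1)[unfolded B_eq]]
    and dAB = det[OF AB[unfolded A_eq B_eq mat3_add]]
  have a: "a32 = 0 \<and> a33 = 0 \<and> a22 = a12"
    using dA det[OF admissible_add[OF V A(1) C, unfolded A_eq mat3_add]]
    by - (cases a13; cases a32; cases a33; cases a22; cases a12; simp)
  have b: "b22 = 1"
    using dB det[OF admissible_add[OF V B(1) C, unfolded B_eq mat3_add]]
    by - (cases b13; cases b22; simp)
  have b32: "b32 = a12"
    using dAB det[OF admissible_add[OF V AB C, unfolded A_eq B_eq mat3_add]] a b
    by - (cases "a13 + b13"; cases b32; cases a12; simp)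
  have "a12 = 0"
    using dB dAB a b b32 by - (cases a12; cases b12; cases b23; cases b33; cases a23; simp)
  then show ?thesis using a by (simp add: A_eq)
qed

text \<open>
  Adding multiples of the Jordan block \<open>N\<close> clears the entries of \<open>A\<close> and \<open>B\<close> at position (1, 2). The
  ten remaining free entries are determined by the equations \<open>det M = 0\<close> and \<open>det (1 + M) = 1\<close>: those for
  \<open>A\<close> and \<open>A + N\<close> leave one bit open, those for \<open>B\<close> and \<open>B + N\<close> another, and those for \<open>A + B\<close> and
  \<open>A + B + N\<close> fix both.
\<close>

lemma T1_normal_form:
  assumes V: "admissible V" and sing: "\<And>M. M \<in> V \<Longrightarrow> det M = 0"
    and N: "mat3 0 1 0 0 0 1 0 0 0 \<in> V" (is "?N \<in> V")
    and A: "A \<in> V" "A *v vec3 1 0 0 = vec3 1 1 0"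
    and B: "B \<in> V" "B *v vec3 1 0 0 = vec3 0 0 1"
  shows "V = T1"
proof -
  have norm: "\<exists>b' c d e f. mat3 p 0 b' q c d r e f \<in> V" if M: "M \<in> V" "M *v vec3 1 0 0 = vec3 p q r" for M p q r
  proof -
    obtain m12 m13 m22 m23 m32 m33 where M_eq: "M = mat3 p m12 m13 q m22 m23 r m32 m33"
      using first_column[OF M(2)] by metis
    show ?thesis
      using M(1) admissible_add[OF V M(1) N] by - (cases m12; simp add: M_eq; blast)
  qed
  obtain a13 a22 a23 a32 a33 where A': "mat3 1 0 a13 1 a22 a23 0 a32 a33 \<in> V"
    using norm[OF A] by blast
  obtain b13 b22 b23 b32 b33 where B': "mat3 0 0 b13 0 b22 b23 1 b32 b33 \<in> V"
    using norm[OF B] by blast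
  note AN = admissible_add[OF V A' N, simplified]
  note BN = admissible_add[OF V B' N, simplified]
  note AB = admissible_add[OF V A' B', simplified]
  note ABN = admissible_add[OF V AN B', simplified]
  note det = admissible_det_mat3[OF V]
  have sing': "a * e * i + b * f * g + c * d * h + a * f * h + b * d * i + c * e * g = 0"
    if "mat3 a b c d e f g h i \<in> V" for a b c d e f g h i
    using sing[OF that] by (simp add: det_mat3)
  have a: "a13 = 1 \<and> a32 = 1 \<and> a33 = 1 \<and> a23 = a22 + 1"
    using det[OF A'] det[OF AN] sing'[OF A'] sing'[OF AN]
    by - (cases a13; cases a32; cases a33; cases a22; cases a23; simp)
  have b: "b22 = 0 \<and> b23 = 1 \<and> b32 = 0 \<and> b33 = b13"
    using det[OF B'] det[OF BN] sing'[OF B'] sing'[OF BN]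
    by - (cases b22; cases b23; cases b32; cases b13; cases b33; simp)
  have ab: "a22 = 1 \<and> b13 = 0"
    using det[OF AB] det[OF ABN] sing'[OF AB] sing'[OF ABN] a b
    by - (cases a22; cases b13; simp)
  define J where "J = mat3 1 0 1 1 1 0 0 1 (1::bit)"
  define D where "D = mat3 0 0 0 0 0 1 1 0 (0::bit)"
  have J: "J \<in> V" and D: "D \<in> V"
    using A' B' a b ab by (simp_all add: J_def D_def)
  have "V = {0, ?N, D, ?N + D, J, J + ?N, J + D, J + (?N + D)}"
    by (rule admissible_eq_span[OF V N D J]) (simp_all add: D_def J_def)
  moreover have "(0 :: bit ^ 3 ^ 3) = mat3 0 0 0 0 0 0 0 0 0" by simp
  ultimately have V_eq: "V = {mat3 0 0 0 0 0 0 0 0 0, ?N, D, ?N + D, J, J + ?N, J + D, J + (?N + D)}"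
    by (simp only:)
  have "T1 \<subseteq> V"
    unfolding V_eq T1_eq set_of_three_bits by (simp add: D_def J_def)
  moreover have "V \<subseteq> T1"
    unfolding V_eq T1_eq set_of_three_bits by (simp add: D_def J_def)
  ultimately show ?thesis by blast
qed

section \<open>A vector killed by two matrices\<close>

text \<open>
  The assumptions say \<open>det (1 + K) = 1\<close> for the matrices \<open>K1\<close> with rows \<open>p, q\<close> and \<open>r, s\<close>, \<open>K2\<close> with the
  primed entries, and \<open>K1 + K2\<close>. If all three were nonzero, then, as in \<open>killer_exists\<close>, each of the three
  nonzero vectors of the plane would be killed by one of them, and each of them would kill just one vector.
  Say \<open>K1 v1 = 0\<close>, \<open>K2 v2 = 0\<close> and \<open>(K1 + K2) (v1 + v2) = 0\<close>, so that \<open>K1 v2 = K2 v1\<close>. This vector is nonzero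
  and differs from \<open>v2\<close> and \<open>v1\<close>, which are not fixed; hence it is \<open>v1 + v2\<close>, and \<open>K1\<close> fixes \<open>v1 + v2\<close>, a
  contradiction.
\<close>

lemma planar_trivial_spectrum:
  fixes p q r s p' q' r' s' :: bit
  assumes "(1 + p) * (1 + s) + q * r = 1" "(1 + p') * (1 + s') + q' * r' = 1"
    "(1 + (p + p')) * (1 + (s + s')) + (q + q') * (r + r') = 1"
  shows "(p = 0 \<and> q = 0 \<and> r = 0 \<and> s = 0) \<or> (p' = 0 \<and> q' = 0 \<and> r' = 0 \<and> s' = 0) \<or>
    (p' = p \<and> q' = q \<and> r' = r \<and> s' = s)"
  using assms by - (cases p; cases q; cases r; cases s; cases p'; cases q'; cases r'; cases s'; simp)

text \<open>
  The lower right 2 by 2 blocks of \<open>M\<close>, \<open>M'\<close> and \<open>M + M'\<close> have trivial spectrum, so one of them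
  vanishes, which gives \<open>E\<close>, supported in the first row. If its row vanished at the second basis vector, \<open>E\<close> would
  be \<open>E13\<close>; by the cofactor equations, the third row of every element of \<open>V\<close> would be a multiple of
  \<open>(0, 0, 1)\<close>, and the first two basis vectors would span an invariant plane.
\<close>

lemma two_killers_coordinates:
  assumes V: "admissible V"
    and M: "M \<in> V" "M \<noteq> 0" "M *v vec3 1 0 0 = 0"
    and M': "M' \<in> V" "M' \<noteq> 0" "M' *v vec3 1 0 0 = 0" "M' \<noteq> M"
    and A: "A \<in> V" "A *v vec3 1 0 0 = vec3 1 1 0"
  shows "similar_subspaces V T2 \<or> similar_subspaces V T3"
proof -
  note det = admissible_det_mat3[OF V]
  obtain E r2 r3 where E: "E \<in> V" "E \<noteq> 0" and E_eq: "E = mat3 0 r2 r3 0 0 0 0 0 0"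
  proof -
    obtain a b p q r s where M_eq: "M = mat3 0 a b 0 p q 0 r s"
      using first_column[OF M(3)[folded vec3_000]] by metis
    obtain a' b' p' q' r' s' where M'_eq: "M' = mat3 0 a' b' 0 p' q' 0 r' s'"
      using first_column[OF M'(3)[folded vec3_000]] by metis
    have MM': "M + M' \<in> V" "M + M' \<noteq> 0"
      using admissible_add[OF V M(1) M'(1)] M'(4) by (simp_all flip: bitmat_eq_iff_sum_0)
    have "(1 + p) * (1 + s) + q * r = 1" "(1 + p') * (1 + s') + q' * r' = 1"
      "(1 + (p + p')) * (1 + (s + s')) + (q + q') * (r + r') = 1"
      using det[OF M(1)[unfolded M_eq]] det[OF M'(1)[unfolded M'_eq]]
        det[OF MM'(1)[unfolded M_eq M'_eq mat3_add]]
      by simp_all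
    then consider "M = mat3 0 a b 0 0 0 0 0 0" | "M' = mat3 0 a' b' 0 0 0 0 0 0"
      | "M + M' = mat3 0 (a + a') (b + b') 0 0 0 0 0 0"
      using planar_trivial_spectrum[of p s q r p' s' q' r'] by (auto simp: M_eq M'_eq)
    then show thesis
      using that M(1,2) M'(1,2) MM' by cases blast+
  qed
  obtain C where C: "C \<in> V" "C \<noteq> 0" "C *v vec3 1 0 0 = 0" "C \<noteq> E"
    using M M' by blast
  obtain c12 c13 c22 c23 c32 c33 where C_eq: "C = mat3 0 c12 c13 0 c22 c23 0 c32 c33"
    using first_column[OF C(3)[folded vec3_000]] by metis
  obtain a12 a13 a22 a23 a32 a33 where A_eq: "A = mat3 1 a12 a13 1 a22 a23 0 a32 a33"
    using first_column[OF A(2)] by metis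
  \<comment> \<open>Otherwise every element of \<open>V\<close> would map the row vector \<open>(0, 0, 1)\<close> to \<open>0\<close> or to itself.\<close>
  have r2: "r2 = 1"
  proof (rule ccontr)
    assume "r2 \<noteq> 1"
    then have r: "r2 = 0" "r3 = 1" using E(2) by (auto simp: E_eq)
    have AC: "A + C \<in> V" using admissible_add[OF V A(1) C(1)] .
    have a32: "a32 = 0"
      using det[OF A(1)[unfolded A_eq]] det[OF admissible_add[OF V A(1) E(1), unfolded A_eq E_eq mat3_add]] r
      by - (cases a13; cases a32; cases a12; cases a33; simp)
    have c32: "c32 = 0"
      using det[OF AC[unfolded A_eq C_eq mat3_add]] a32 r
        det[OF admissible_add[OF V AC E(1), unfolded A_eq C_eq E_eq mat3_add]]
      by - (cases "a13 + c13"; cases c32; cases "a12 + c12"; cases "a33 + c33"; simp)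
    have "V = {0, E, C, E + C, A, A + E, A + C, A + (E + C)}"
      using C(4) by (intro admissible_eq_span[OF V E(1) C(1) A(1) E(2) C(2)])
        (simp_all add: E_eq C_eq A_eq)
    moreover have "vec3 0 0 1 v* M = 0 \<or> vec3 0 0 1 v* M = vec3 0 0 1"
      if "M \<in> {0, E, C, E + C, A, A + E, A + C, A + (E + C)}" for M
      using that a32 c32 bit_eq_0_or_1
      by - (elim insertE emptyE; simp add: E_eq C_eq A_eq)
    ultimately show False
      using admissible_row[OF V, of "vec3 0 0 1"] by auto
  qed
  \<comment> \<open>The new third basis vector \<open>(0, r3, 1)\<close> is in the kernel of \<open>E\<close>, so that \<open>E\<close> becomes \<open>E12\<close>.\<close>
  obtain P where P: "invertible P" "P *v vec3 1 0 0 = vec3 1 0 0" "P *v vec3 0 1 0 = vec3 0 1 0"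
    "P *v vec3 0 r3 1 = vec3 0 0 1"
    by (rule change_of_basis[of "vec3 1 0 0" "vec3 0 1 0" "vec3 0 r3 1"]) auto
  note conj = conj_mat_mult_vec[OF P(1)]
  let ?E = "mat3 0 1 0 0 0 0 0 0 (0::bit)"
  have "conj_mat P E = ?E"
  proof (rule columns_eqI)
    show "conj_mat P E *v vec3 1 0 0 = vec3 0 0 0"
      using conj[of E "vec3 1 0 0"] by (simp add: P E_eq vec3_000)
    show "conj_mat P E *v vec3 0 1 0 = vec3 1 0 0"
      using conj[of E "vec3 0 1 0"] r2 by (simp add: P E_eq)
    show "conj_mat P E *v vec3 0 0 1 = vec3 0 0 0"
      using conj[of E "vec3 0 r3 1"] r2 by (simp add: P E_eq vec3_000)
  qed
  moreover have "conj_mat P C *v vec3 1 0 0 = vec3 0 0 0"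
    using conj[of C "vec3 1 0 0"] C(3) by (simp add: P)
  moreover have "conj_mat P A *v vec3 1 0 0 = vec3 1 1 0"
  proof -
    have "vec3 1 1 0 = vec3 1 0 0 + vec3 0 1 (0::bit)" by simp
    then have "P *v vec3 1 1 0 = vec3 1 1 0"
      by (metis P(2,3) matrix_vector_right_distrib)
    then show ?thesis
      using conj[of A "vec3 1 0 0"] A(2) by (simp add: P)
  qed
  moreover have "conj_mat P C \<noteq> 0" "conj_mat P C \<noteq> conj_mat P E"
    using C(2,4) conj_mat_eq_0_iff[OF P(1)] inj_conj_mat[OF P(1)] by (auto dest: injD)
  ultimately have "conj_mat P ` V = T2 \<or> conj_mat P ` V = T3"
    using T2_T3_normal_form[OF admissible_conj_mat[OF P(1) V], of "conj_mat P C" "conj_mat P A"]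
      conj_mat_mem[of _ V P] A(1) C(1) E(1) by metis
  then show ?thesis
    using P(1) unfolding similar_subspaces_iff_conj_mat by metis
qed

text \<open>
  Choosing \<open>y = x + A x\<close> rather than \<open>A x\<close> as second basis vector gives \<open>A\<close> the first column that the
  generator with \<open>a = 1\<close> has in \<open>T2\<close> and \<open>T3\<close>.
\<close>

lemma two_killers:
  assumes V: "admissible V" and x: "x \<noteq> 0"
    and M: "M \<in> V" "M \<noteq> 0" "M *v x = 0"
    and M': "M' \<in> V" "M' \<noteq> 0" "M' *v x = 0" "M' \<noteq> M"
  shows "similar_subspaces V T2 \<or> similar_subspaces V T3"
proof -
  obtain A where A: "A \<in> V" "A *v x \<noteq> 0"
    using admissible_not_killed[OF V x] by blast
  define y where "y = x + A *v x"
  have Ax: "A *v x = x + y" by (simp add: y_def)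
  have y: "y \<noteq> 0" "y \<noteq> x"
    using admissible_no_fixed[OF V A(1), of x] x A(2) Ax by auto
  obtain z where z: "z \<notin> {0, x, y, x + y}" by (rule exists_outside_plane)
  obtain P where P: "invertible P" "P *v x = vec3 1 0 0" "P *v y = vec3 0 1 0"
    by (rule change_of_basis[of x y z]) (use x y z in auto)
  note conj = conj_mat_mult_vec[OF P(1), of _ x, unfolded P]
  have "conj_mat P A *v vec3 1 0 0 = vec3 1 1 0"
    by (simp add: conj Ax matrix_vector_right_distrib P)
  moreover have "conj_mat P M' \<noteq> conj_mat P M"
    using M'(4) inj_conj_mat[OF P(1)] by (auto dest: injD)
  ultimately have "similar_subspaces (conj_mat P ` V) T2 \<or> similar_subspaces (conj_mat P ` V) T3"
    using M M' A(1)
    by (intro two_killers_coordinates[OF admissible_conj_mat[OF P(1) V],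
          of "conj_mat P M" "conj_mat P M'" "conj_mat P A"])
      (simp_all add: conj conj_mat_eq_0_iff[OF P(1)])
  moreover have "similar_subspaces V (conj_mat P ` V)"
    using P(1) by (auto simp: similar_subspaces_iff_conj_mat)
  ultimately show ?thesis using similar_subspaces_trans by blast
qed

section \<open>Vectors with a unique killer\<close>

text \<open>
  An injective map \<open>M \<mapsto> M x\<close> would be a bijection of \<open>V\<close> onto the eight vectors; but the value
  \<open>x\<close> is not attained.
\<close>

lemma killer_exists:
  assumes V: "admissible V" and x: "x \<noteq> 0"
  obtains M where "M \<in> V" "M \<noteq> 0" "M *v x = 0"
proof -
  have "\<not> inj_on (\<lambda>M. M *v x) V"
  proof
    assume "inj_on (\<lambda>M. M *v x) V"
    then have "card ((\<lambda>M. M *v x) ` V) = CARD(bit ^ 3)"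
      by (simp add: card_image admissible_card[OF V])
    then have "(\<lambda>M. M *v x) ` V = UNIV"
      by (intro card_subset_eq) simp_all
    then obtain M where "M \<in> V" "M *v x = x" by (metis UNIV_I imageE)
    then show False using admissible_no_fixed[OF V] x by blast
  qed
  then obtain A B where AB: "A \<in> V" "B \<in> V" "A *v x = B *v x" "A \<noteq> B"
    by (auto simp: inj_on_def)
  show thesis
  proof (rule that)
    show "A + B \<in> V" using admissible_add[OF V] AB by blast
    show "A + B \<noteq> 0" using AB(4) by (simp flip: bitmat_eq_iff_sum_0)
    show "(A + B) *v x = 0" using AB(3) by (simp add: matrix_vector_mult_add_rdistrib)
  qed
qed

lemma exists_outside:
  assumes V: "admissible V" and S: "card S < 8"
  obtains M where "M \<in> V" "M \<notin> S"
proof -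
  have "\<not> V \<subseteq> S"
    using card_mono[of S V] admissible_card[OF V] S by auto
  then show thesis using that by blast
qed

text \<open>
  Only uniqueness is demanded, since \<open>killer_exists\<close> provides existence.
\<close>

definition unique_killers :: "(bit ^ 3 ^ 3) set \<Rightarrow> bool"
  where "unique_killers V \<longleftrightarrow>
    (\<forall>x M M'. x \<noteq> 0 \<longrightarrow> M \<in> V - {0} \<longrightarrow> M' \<in> V - {0} \<longrightarrow> M *v x = 0 \<longrightarrow> M' *v x = 0 \<longrightarrow> M' = M)"

lemma unique_killersD:
  assumes "unique_killers V" "x \<noteq> 0" "M \<in> V" "M \<noteq> 0" "M *v x = 0" "M' \<in> V" "M' \<noteq> 0" "M' *v x = 0"
  shows "M' = M"
  using assms unfolding unique_killers_def by blast

text \<open>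
  Modulo its only killer \<open>C\<close>, the space \<open>V\<close> acts faithfully on \<open>w\<close>, so the image \<open>V w\<close> is a plane. It does
  not contain \<open>w\<close>, hence the two vectors obtained here form a basis together with \<open>w\<close>.
\<close>

lemma image_complement:
  assumes V: "admissible V" and uniq: "unique_killers V"
    and C: "C \<in> V" "C \<noteq> 0" "C *v w = 0" and w: "w \<noteq> 0"
  obtains A B where "A \<in> V" "B \<in> V" "A *v w \<noteq> 0" "B *v w \<noteq> 0" "B *v w \<noteq> A *v w"
proof -
  have nz: "M *v w \<noteq> 0" if "M \<in> V" "M \<noteq> 0" "M \<noteq> C" for M
    using unique_killersD[OF uniq w C] that by blast
  \<comment> \<open>Two generators of \<open>V\<close> modulo \<open>C\<close>.\<close>
  obtain A where A: "A \<in> V" "A \<notin> {0, C}"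
    by (rule exists_outside[OF V, of "{0, C}"]) (auto simp: card_insert_if)
  obtain B where B: "B \<in> V" "B \<notin> {0, C, A, A + C}"
    by (rule exists_outside[OF V, of "{0, C, A, A + C}"]) (auto simp: card_insert_if)
  have "(A + B) *v w \<noteq> 0"
  proof (rule nz)
    show "A + B \<in> V" using admissible_add[OF V] A(1) B(1) by blast
    show "A + B \<noteq> 0" using B(2) by (auto simp flip: bitmat_eq_iff_sum_0)
    show "A + B \<noteq> C"
    proof
      assume "A + B = C"
      then have "B = A + C" by (metis bitmat_double(2))
      then show False using B(2) by simp
    qed
  qed
  then have "B *v w \<noteq> A *v w"
    by (auto simp: matrix_vector_mult_add_rdistrib)
  then show thesis
    using that A B nz by auto
qed

text \<open>
  In the basis \<open>w, A w, B w\<close> the matrix \<open>C\<close> is \<open>E13\<close>, and \<open>rank_one_normal_form\<close> shows that \<open>A\<close> kills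
  \<open>A w\<close>, as \<open>C\<close> does. Uniqueness gives \<open>A = C\<close>, although \<open>A\<close> does not kill \<open>w\<close>.
\<close>

lemma rank_one_impossible_adapted:
  assumes V: "admissible V" and uniq: "unique_killers V"
    and C: "C \<in> V" "C \<noteq> 0" "C *v w = 0" and w: "w \<noteq> 0" and im: "\<And>v. C *v v \<in> {0, w}"
    and A: "A \<in> V" "A *v w \<noteq> 0" and B: "B \<in> V" "B *v w \<noteq> 0" "B *v w \<noteq> A *v w"
    and CA: "C *v (A *v w) = 0"
  shows False
proof -
  have fixed: "M *v w \<noteq> w" if "M \<in> V" for M
    using admissible_no_fixed[OF V that] w by blast
  have "B *v w \<noteq> w + A *v w"
    using fixed[OF admissible_add[OF V A(1) B(1)]]
    by (metis matrix_vector_mult_add_rdistrib bitvec_double(2) add.commute)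
  then obtain P where P: "invertible P" "P *v w = vec3 1 0 0" "P *v (A *v w) = vec3 0 1 0"
    "P *v (B *v w) = vec3 0 0 1"
    using change_of_basis[of w "A *v w" "B *v w"] w A B fixed by metis
  note conj = conj_mat_mult_vec[OF P(1)]
  have CB: "C *v (B *v w) = w"
  proof (rule ccontr)
    assume "C *v (B *v w) \<noteq> w"
    then have "C *v (B *v w) = 0" using im by blast
    then have "conj_mat P C = mat3 0 0 0 0 0 0 0 0 0"
      using conj[of C w] conj[of C "A *v w"] conj[of C "B *v w"] C(3) CA
      by (intro columns_eqI) (simp_all add: P vec3_000)
    then show False using C(2) conj_mat_eq_0_iff[OF P(1), of C] by simp
  qed
  have "conj_mat P C = mat3 0 0 1 0 0 0 0 0 0"
    using conj[of C w] conj[of C "A *v w"] conj[of C "B *v w"] C(3) CA CB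
    by (intro columns_eqI) (simp_all add: P vec3_000)
  then have "mat3 0 0 1 0 0 0 0 0 0 \<in> conj_mat P ` V"
    using C(1) by (metis conj_mat_mem)
  then have "conj_mat P A *v vec3 0 1 0 = 0"
    using conj[of A w] conj[of B w] A(1) B(1)
    by (intro rank_one_normal_form[OF admissible_conj_mat[OF P(1) V], of _ "conj_mat P B"])
      (simp_all add: P)
  then have "P *v (A *v (A *v w)) = 0"
    using conj[of A "A *v w"] by (simp add: P)
  then have "A *v (A *v w) = 0"
    using matrix_inv_cancel[OF P(1)]
    by (metis matrix_vector_mul_assoc matrix_vector_mul_lid matrix_vector_mult_0_right)
  moreover have "A \<noteq> 0" using A(2) by auto
  ultimately have "A = C"
    using unique_killersD[OF uniq A(2) C(1,2) CA] A(1) by blast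
  then show False using A(2) C(3) by simp
qed

text \<open>
  If \<open>C\<close> kills two independent vectors, its range is a line \<open>{0, w}\<close>, and \<open>C w = 0\<close> because \<open>w\<close> is not
  fixed. The plane \<open>V w\<close> meets the kernel of \<open>C\<close> nontrivially, so one of \<open>A w\<close>, \<open>B w\<close>, \<open>A w + B w\<close> is
  killed by \<open>C\<close>, and after renaming it is \<open>A w\<close>.
\<close>

lemma rank_one_impossible:
  assumes V: "admissible V" and uniq: "unique_killers V"
    and C: "C \<in> V" "C \<noteq> 0" "C *v x = 0" "C *v y = 0" and xy: "x \<noteq> 0" "y \<noteq> 0"
  shows "y = x"
proof (rule ccontr)
  assume "y \<noteq> x"
  obtain z where z: "z \<notin> {0, x, y, x + y}" by (rule exists_outside_plane)
  define w where "w = C *v z"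
  have im: "C *v v \<in> {0, w}" for v
  proof -
    obtain a b c where "v = a *s x + b *s y + c *s z"
      using basis_expansion[of x y z v] xy z \<open>y \<noteq> x\<close> by auto
    then have "C *v v = c *s w"
      by (simp add: matrix_vector_right_distrib vector_scalar_commute C w_def)
    then show ?thesis by (cases c) simp_all
  qed
  have w: "w \<noteq> 0"
  proof
    assume "w = 0"
    then have "C *v v = 0 *v v" for v using im[of v] by simp
    then show False using C(2) by (auto simp: matrix_eq)
  qed
  have Cw: "C *v w = 0"
    using im[of w] admissible_no_fixed[OF V C(1), of w] w by blast
  obtain A B where AB: "A \<in> V" "B \<in> V" "A *v w \<noteq> 0" "B *v w \<noteq> 0" "B *v w \<noteq> A *v w"
    by (rule image_complement[OF V uniq C(1,2) Cw w])
  note imp = rank_one_impossible_adapted[OF V uniq C(1,2) Cw w im]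
  have sum: "(A + B) *v w = A *v w + B *v w" by (rule matrix_vector_mult_add_rdistrib)
  have "A + B \<in> V" using admissible_add[OF V AB(1,2)] .
  moreover have "A *v w + B *v w \<noteq> 0"
    using AB(5) by (metis bitvec_double(2) add.right_neutral)
  moreover have "C *v (A *v w + B *v w) = C *v (A *v w) + C *v (B *v w)"
    by (rule matrix_vector_right_distrib)
  moreover have "C *v (A *v w) \<in> {0, w}" "C *v (B *v w) \<in> {0, w}"
    using im by blast+
  ultimately show False
    using imp[of A B] imp[of B A] imp[of "A + B" A] AB unfolding sum
    by auto
qed

text \<open>
  The map from nonzero vectors to their killers is injective by \<open>rank_one_impossible\<close>, hence a bijection onto
  the seven nonzero elements of \<open>V\<close>.
\<close>

lemma all_singular:
  assumes V: "admissible V" and uniq: "unique_killers V" and M: "M \<in> V"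
  obtains x where "x \<noteq> 0" "M *v x = 0"
proof (cases "M = 0")
  case True
  then show thesis using that[of "vec3 1 0 0"] by simp
next
  case False
  have "\<forall>x. \<exists>M. x \<noteq> 0 \<longrightarrow> M \<in> V \<and> M \<noteq> 0 \<and> M *v x = 0"
    using killer_exists[OF V] by metis
  then obtain k where k: "\<And>x. x \<noteq> 0 \<Longrightarrow> k x \<in> V \<and> k x \<noteq> 0 \<and> k x *v x = 0"
    by metis
  have inj: "inj_on k (- {0})"
    using rank_one_impossible[OF V uniq] k by (intro inj_onI) (metis ComplD singletonI)
  have "0 \<in> V" using admissible_add[OF V M M] by simp
  then have "card (V - {0}) = card (- {0 :: bit ^ 3})"
    using admissible_card[OF V] by (simp add: Compl_eq_Diff_UNIV)
  then have "k ` (- {0}) = V - {0}"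
    using k inj by (intro card_subset_eq) (auto simp: card_image)
  then obtain x where "x \<in> - {0}" "M = k x"
    using M False by blast
  then show thesis using that k by auto
qed

text \<open>
  The coefficient of \<open>M\<close> is the sum of the principal 2 by 2 minors.
\<close>

lemma mat3_cayley_hamilton:
  fixes a b c d e f g h i :: "'a::field"
  defines "M \<equiv> mat3 a b c d e f g h i"
  shows "M ** M ** M + mat_scale (a * e - b * d + (a * i - c * g) + (e * i - f * h)) M =
    mat_scale (trace M) (M ** M) + mat_scale (det M) (mat 1)"
proof -
  have scale: "mat_scale k (mat3 a b c d e f g h i) =
    mat3 (k * a) (k * b) (k * c) (k * d) (k * e) (k * f) (k * g) (k * h) (k * i)"
    for k a b c d e f g h i :: 'a
    by (simp add: mat_scale_def mat3_def vec_eq_iff forall_3)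
  show ?thesis
    unfolding M_def mat_1_eq_mat3 det_mat3
    by (simp add: scale) (intro conjI; algebra)
qed

text \<open>
  The characteristic polynomial at 1 is \<open>1 + trace M + c + det M\<close> with \<open>c\<close> the remaining coefficient, so the
  assumptions give \<open>c = 0\<close> as well.
\<close>

lemma nilpotent_cube:
  fixes M :: "bit ^ 3 ^ 3"
  assumes "det M = 0" "trace M = 0" "det (mat 1 + M) = 1"
  shows "M ** M ** M = 0"
proof -
  obtain a b c d e f g h i where M: "M = mat3 a b c d e f g h i" by (rule mat3_exhaust)
  have "det (mat 1 + M) = 1 + trace M + (a * e - b * d + (a * i - c * g) + (e * i - f * h)) + det M"
    by (simp add: M mat_1_eq_mat3 det_mat3 algebra_simps)
  then have "a * e - b * d + (a * i - c * g) + (e * i - f * h) = 0"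
    using assms by simp
  then show ?thesis
    using mat3_cayley_hamilton[of a b c d e f g h i, folded M] assms by simp
qed

text \<open>
  In the Jordan basis \<open>x, N z, z\<close> of \<open>N\<close>, the matrices \<open>A\<close> and \<open>B\<close> have the first columns of generators of \<open>T1\<close>.
\<close>

lemma jordan_chain_T1:
  assumes V: "admissible V" and sing: "\<And>M. M \<in> V \<Longrightarrow> det M = 0"
    and N: "N \<in> V" and z: "N *v (N *v z) = x" "x \<noteq> 0" "N *v x = 0"
    and A: "A \<in> V" "A *v x = x + N *v z" and B: "B \<in> V" "B *v x = z"
  shows "similar_subspaces V T1"
proof -
  let ?y = "N *v z"
  have Nxy: "N *v (x + ?y) = x"
    by (simp add: matrix_vector_right_distrib z)
  have ind: "?y \<noteq> 0" "z \<noteq> 0" "?y \<noteq> x" "z \<noteq> x" "z \<noteq> ?y" "z \<noteq> x + ?y"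
    using z Nxy by (metis matrix_vector_mult_0_right)+
  obtain P where P: "invertible P" "P *v x = vec3 1 0 0" "P *v ?y = vec3 0 1 0" "P *v z = vec3 0 0 1"
    using change_of_basis[of x ?y z] z(2) ind by metis
  note conj = conj_mat_mult_vec[OF P(1)]
  have "conj_mat P N = mat3 0 1 0 0 0 1 0 0 0"
    using conj[of N x] conj[of N ?y] conj[of N z]
    by (intro columns_eqI) (simp_all add: P z vec3_000)
  then have N': "mat3 0 1 0 0 0 1 0 0 0 \<in> conj_mat P ` V"
    using N by (metis conj_mat_mem)
  have "conj_mat P A *v vec3 1 0 0 = vec3 1 1 0" "conj_mat P B *v vec3 1 0 0 = vec3 0 0 1"
    using conj[of A x] conj[of B x] by (simp_all add: P A B matrix_vector_right_distrib)
  moreover have "det M = 0" if "M \<in> conj_mat P ` V" for M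
    using that sing by (auto simp: conj_mat_def det_mul)
  ultimately have "conj_mat P ` V = T1"
    using T1_normal_form[OF admissible_conj_mat[OF P(1) V] _ N'] conj_mat_mem A(1) B(1) by metis
  then show ?thesis
    using P(1) unfolding similar_subspaces_iff_conj_mat by metis
qed

text \<open>
  A nonzero singular matrix \<open>N\<close> of trace zero in \<open>V\<close> is nilpotent by \<open>nilpotent_cube\<close> and its kernel is a
  line by \<open>rank_one_impossible\<close>, so it is a single Jordan block; let \<open>t, y = N t, x = N y\<close> be a Jordan basis. To apply \<open>jordan_chain_T1\<close>, the chain
  has to start at some \<open>z\<close> in \<open>V x\<close> for which \<open>x + N z\<close> lies in \<open>V x\<close> too. As \<open>V x\<close> is a complement of
  the line of \<open>x\<close>, it contains \<open>A x\<close> and \<open>B x\<close> congruent to \<open>y\<close> and \<open>t\<close> modulo \<open>x\<close>. If \<open>A x = x + y\<close>, then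
  \<open>z = B x\<close> works, since \<open>N z = y\<close>. If \<open>A x = y\<close>, then \<open>z = y + B x\<close> works, since \<open>N z = x + y\<close>.
\<close>

lemma unique_killers_T1:
  assumes V: "admissible V" and uniq: "unique_killers V"
  shows "similar_subspaces V T1"
proof -
  have sing: "det M = 0" if M: "M \<in> V" for M
  proof -
    obtain x where "x \<noteq> 0" "M *v x = 0" by (rule all_singular[OF V uniq M])
    then have "\<not> invertible M"
      unfolding invertible_left_inverse matrix_left_invertible_ker by blast
    then show ?thesis by (simp add: invertible_det_nz)
  qed
  \<comment> \<open>The trace is linear, so it cannot be 1 on all of \<open>A\<close>, \<open>B\<close> and \<open>A + B\<close>.\<close>
  obtain N where N: "N \<in> V" "N \<noteq> 0" "trace N = 0"
  proof -
    obtain A where A: "A \<in> V" "A \<notin> {0}"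
      by (rule exists_outside[OF V, of "{0}"]) simp
    obtain B where B: "B \<in> V" "B \<notin> {0, A}"
      by (rule exists_outside[OF V, of "{0, A}"]) (auto simp: card_insert_if)
    have "A + B \<noteq> 0" using B(2) by (auto simp flip: bitmat_eq_iff_sum_0)
    moreover have "A + B \<in> V" using admissible_add[OF V A(1) B(1)] .
    moreover have "trace A = 0 \<or> trace B = 0 \<or> trace (A + B) = 0"
      by (cases "trace A"; cases "trace B"; simp add: trace_add)
    ultimately show thesis using that A B by blast
  qed
  have cube: "N *v (N *v (N *v v)) = 0" for v
    using nilpotent_cube[OF sing[OF N(1)] N(3) admissible_det[OF V N(1)]]
    by (simp add: matrix_vector_mul_assoc matrix_mul_assoc)
  note ker = rank_one_impossible[OF V uniq N(1,2)]
  \<comment> \<open>If the square were zero, \<open>N\<close> would map every vector outside its kernel \<open>{0, x}\<close> to \<open>x\<close>, and the sum of two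
    suitable such vectors would lie in the kernel too.\<close>
  obtain t where t: "N *v (N *v t) \<noteq> 0"
  proof (rule ccontr)
    assume "\<not> thesis"
    then have sq: "N *v (N *v v) = 0" for v using that by blast
    obtain x where x: "x \<noteq> 0" "N *v x = 0" by (rule all_singular[OF V uniq N(1)])
    have im: "N *v v = x" if "v \<notin> {0, x}" for v
      using ker[of x "N *v v"] ker[of x v] x sq that by blast
    obtain y where y: "y \<notin> {0, x, x, x + x}" by (rule exists_outside_plane)
    obtain z where z: "z \<notin> {0, x, y, x + y}" by (rule exists_outside_plane)
    have "z = y + (y + z)" by simp
    then have "y + z \<noteq> 0" "y + z \<noteq> x"
      using z by (metis add.right_neutral insertI1 insertI2, metis add.commute insertI1 insertI2)
    moreover have "N *v (y + z) = 0"
      using im[of y] im[of z] y z by (simp add: matrix_vector_right_distrib)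
    ultimately show False using im[of "y + z"] x(1) by simp
  qed
  define y where "y = N *v t"
  define x where "x = N *v y"
  have Ny: "N *v t = y" "N *v y = x" "N *v x = 0" "x \<noteq> 0"
    using t cube by (simp_all add: x_def y_def)
  \<comment> \<open>The plane \<open>V x\<close> is a complement of the line of \<open>x\<close>, so it meets each of its cosets.\<close>
  have hit: "\<exists>M\<in>V. M *v x = v \<or> M *v x = x + v" for v
  proof -
    obtain A B where AB: "A \<in> V" "B \<in> V" "A *v x \<noteq> 0" "B *v x \<noteq> 0" "B *v x \<noteq> A *v x"
      by (rule image_complement[OF V uniq N(1,2) Ny(3,4)])
    have sum: "(A + B) *v x = A *v x + B *v x" by (rule matrix_vector_mult_add_rdistrib)
    have fixed: "M *v x \<noteq> x" if "M \<in> V" for M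
      using admissible_no_fixed[OF V that] Ny(4) by blast
    have AB': "A + B \<in> V" using admissible_add[OF V AB(1,2)] .
    have "B *v x \<noteq> x + A *v x"
      using fixed[OF AB'] sum by (metis bitvec_double(2) add.commute)
    then obtain a b c where v: "v = a *s x + b *s (A *v x) + c *s (B *v x)"
      using basis_expansion[of x "A *v x" "B *v x" v] Ny(4) AB fixed by metis
    have "0 \<in> V" using admissible_add[OF V N(1) N(1)] by simp
    then have "mat_scale b A + mat_scale c B \<in> V"
      using AB AB' by (cases b; cases c; simp)
    moreover have "(mat_scale b A + mat_scale c B) *v x = b *s (A *v x) + c *s (B *v x)"
      by (cases b; cases c; simp add: sum)
    ultimately show ?thesis
      by (intro bexI[of _ "mat_scale b A + mat_scale c B"]) (cases a; simp add: v add.assoc)+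
  qed
  obtain A where A: "A \<in> V" "A *v x = y \<or> A *v x = x + y" using hit by blast
  obtain B where B: "B \<in> V" "B *v x = t \<or> B *v x = x + t" using hit by blast
  have NB: "N *v (B *v x) = y"
    using B(2) Ny by (auto simp: matrix_vector_right_distrib)
  show ?thesis
  proof (cases "A *v x = x + y")
    case True
    show ?thesis
    proof (rule jordan_chain_T1[OF V sing N(1) _ Ny(4,3) A(1) _ B(1) refl])
      show "N *v (N *v (B *v x)) = x" by (simp only: NB Ny)
      show "A *v x = x + N *v (B *v x)" by (simp only: NB True)
    qed
  next
    case False
    then have Ax: "A *v x = y" using A(2) by blast
    have sum: "(A + B) *v x = y + B *v x"
      by (simp add: matrix_vector_mult_add_rdistrib Ax)
    have Nz: "N *v (y + B *v x) = x + y"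
      by (simp add: matrix_vector_right_distrib NB Ny)
    show ?thesis
    proof (rule jordan_chain_T1[OF V sing N(1) _ Ny(4,3) A(1) _ admissible_add[OF V A(1) B(1)] sum])
      show "N *v (N *v (y + B *v x)) = x" by (simp only: Nz) (simp add: matrix_vector_right_distrib Ny)
      show "A *v x = x + N *v (y + B *v x)" by (simp only: Nz Ax) simp
    qed
  qed
qed

lemma classification:
  assumes V: "admissible V"
  shows "similar_subspaces V T1 \<or> similar_subspaces V T2 \<or> similar_subspaces V T3"
proof (cases "unique_killers V")
  case True
  then show ?thesis using unique_killers_T1[OF V] by blast
next
  case False
  then obtain x M M' where "x \<noteq> 0" "M \<in> V" "M \<noteq> 0" "M *v x = 0" "M' \<in> V" "M' \<noteq> 0" "M' *v x = 0" "M' \<noteq> M"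
    unfolding unique_killers_def by blast
  then show ?thesis using two_killers[OF V] by blast
qed

section \<open>The three model spaces\<close>

lemma T_elements:
  "T1 = {mat3 0 0 0 0 0 0 0 0 0, mat3 0 1 0 0 0 0 1 0 0, mat3 0 0 0 0 0 1 1 0 0, mat3 0 1 0 0 0 1 0 0 0,
         mat3 1 0 1 1 1 0 0 1 1, mat3 1 1 1 1 1 0 1 1 1, mat3 1 0 1 1 1 1 1 1 1, mat3 1 1 1 1 1 1 0 1 1}"
  "T2 = {mat3 0 0 0 0 0 0 0 0 0, mat3 0 1 0 0 0 0 0 0 0, mat3 0 0 0 0 0 1 0 0 0, mat3 0 1 0 0 0 1 0 0 0,
         mat3 1 0 1 1 1 0 0 1 1, mat3 1 1 1 1 1 0 0 1 1, mat3 1 0 1 1 1 1 0 1 1, mat3 1 1 1 1 1 1 0 1 1}"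
  "T3 = {mat3 0 0 0 0 0 0 0 0 0, mat3 0 1 0 0 0 0 0 0 0, mat3 0 0 0 0 0 1 0 0 0, mat3 0 1 0 0 0 1 0 0 0,
         mat3 1 0 1 1 0 0 0 1 1, mat3 1 1 1 1 0 0 0 1 1, mat3 1 0 1 1 0 1 0 1 1, mat3 1 1 1 1 0 1 0 1 1}"
  unfolding T1_eq T2_eq T3_eq set_of_three_bits by simp_all

lemma irreducibleI:
  fixes V :: "(bit ^ 3 ^ 3) set"
  assumes "\<And>F x. vec.subspace F \<Longrightarrow> (\<And>M y. M \<in> V \<Longrightarrow> y \<in> F \<Longrightarrow> M *v y \<in> F) \<Longrightarrow> x \<in> F \<Longrightarrow> x \<noteq> 0
    \<Longrightarrow> vec3 1 0 0 \<in> F \<and> vec3 0 1 0 \<in> F \<and> vec3 0 0 1 \<in> F"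
  shows "irreducible_subspace V"
  unfolding irreducible_subspace_def
proof (clarify)
  fix F :: "(bit ^ 3) set"
  assume F: "vec.subspace F" "F \<noteq> UNIV" "F \<noteq> {0}" and inv: "\<forall>X\<in>F. {M *v X |M. M \<in> V} \<subseteq> F"
  have "0 \<in> F" using F(1) by (simp add: vec_subspace_bit_iff)
  then obtain x where "x \<in> F" "x \<noteq> 0" using F(3) by blast
  then have e: "vec3 1 0 0 \<in> F" "vec3 0 1 0 \<in> F" "vec3 0 0 1 \<in> F"
    using assms[OF F(1)] inv by blast+
  have "v \<in> F" for v
  proof -
    obtain a b c where "v = a *s vec3 1 0 0 + b *s vec3 0 1 0 + c *s vec3 0 0 1"
      by (rule basis_expansion[of "vec3 1 0 0" "vec3 0 1 0" "vec3 0 0 1" v]) auto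
    then show "v \<in> F"
      using e F(1) by (simp add: vec.subspace_add vec.subspace_scale)
  qed
  then show False using F(2) by blast
qed

lemma card_8_subspace_dim:
  fixes V :: "(bit ^ 3 ^ 3) set"
  assumes "matvs.subspace V" "card V = 8"
  shows "matvs.dim V = 3"
proof -
  have "(2::nat) ^ matvs.dim V = 2 ^ 3"
    using card_subspace_bit[OF assms(1)] assms(2) by simp
  then show ?thesis by (subst (asm) power_inject_exp) simp_all
qed

lemma T_linear_trivial_spectrum:
  assumes "T \<in> {T1, T2, T3}"
  shows "matvs.subspace T" "card T = 8" "trivial_spectrum T"
proof -
  have "0 \<in> T \<and> (\<forall>A\<in>T. \<forall>B\<in>T. A + B \<in> T)"
    using assms by (elim insertE emptyE; simp add: T_elements)
  then show "matvs.subspace T" by (simp add: subspace_bit_iff)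
  show "card T = 8"
    using assms by (elim insertE emptyE; simp add: T_elements)
  have "\<forall>M\<in>T. det (mat 1 + M) = 1"
    using assms by (elim insertE emptyE; simp add: T_elements mat_1_eq_mat3 det_mat3)
  then show "trivial_spectrum T"
    by (simp add: trivial_spectrum_bit_iff no_fixed_vector_iff_det)
qed

text \<open>
  Let \<open>F\<close> be a nonzero invariant subspace. The nilpotent Jordan block \<open>E12 + E23\<close> leads from any nonzero
  vector to the first basis vector \<open>e1\<close>. A generator with \<open>a = 1\<close> maps \<open>e1\<close> to \<open>e1 + e2\<close> and \<open>e2\<close> to
  \<open>k e2 + e3\<close>, so \<open>F\<close> contains the whole basis.
\<close>

lemma T_irreducible:
  assumes T: "T \<in> {T1, T2, T3}"
  shows "irreducible_subspace T"
proof (rule irreducibleI)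
  fix F :: "(bit ^ 3) set" and x
  assume F: "vec.subspace F" and inv: "\<And>M y. M \<in> T \<Longrightarrow> y \<in> F \<Longrightarrow> M *v y \<in> F"
    and x: "x \<in> F" "x \<noteq> 0"
  have add: "u + v \<in> F" if "u \<in> F" "v \<in> F" for u v
    using F that by (simp add: vec_subspace_bit_iff)
  have N: "mat3 0 1 0 0 0 1 0 0 0 \<in> T"
    using T by (elim insertE emptyE; simp add: T_elements)
  obtain k where J: "mat3 1 0 1 1 k 0 0 1 1 \<in> T"
    using T by (elim insertE emptyE; force simp: T_elements)
  have shift: "vec3 q r 0 \<in> F" if "vec3 p q r \<in> F" for p q r
    using inv[OF N that] by simp
  obtain a b c where abc: "x = vec3 a b c" by (rule vec3_exhaust)
  have e1: "vec3 1 0 0 \<in> F"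
    using x shift[of a b c] shift[of b c 0] unfolding abc by - (cases c; cases b; simp)
  have e2: "vec3 0 1 0 \<in> F"
    using add[OF inv[OF J e1] e1] by simp
  have "vec3 0 k 1 \<in> F"
    using inv[OF J e2] by simp
  then have "vec3 0 0 1 \<in> F"
    using add[OF _ e2, of "vec3 0 k 1"] by - (cases k; simp)
  then show "vec3 1 0 0 \<in> F \<and> vec3 0 1 0 \<in> F \<and> vec3 0 0 1 \<in> F"
    using e1 e2 by blast
qed

lemma T_irreducible_trivial_spectrum:
  assumes "T \<in> {T1, T2, T3}"
  shows "irreducible_trivial_spectrum_3dim T"
  unfolding irreducible_trivial_spectrum_3dim_def
  using T_linear_trivial_spectrum[OF assms] T_irreducible[OF assms] card_8_subspace_dim by blast

lemma T1_no_square_zero: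
  assumes "M \<in> T1" "M ** M = 0"
  shows "M = 0"
proof -
  obtain a b c where "M = mat3 a b a a a c (b + c) a a"
    using assms(1) by (auto simp: T1_eq)
  then show ?thesis
    using assms(2) by - (cases a; cases b; cases c; simp)
qed

text \<open>
  The square-zero matrix \<open>E12\<close> would be conjugate to a nonzero square-zero element of \<open>T1\<close>.
\<close>

lemma T1_not_similar:
  assumes "mat3 0 1 0 0 0 0 0 0 0 \<in> V"
  shows "\<not> similar_subspaces T1 V"
proof
  let ?E = "mat3 0 1 0 0 0 0 0 0 (0::bit)"
  assume "similar_subspaces T1 V"
  then obtain P where P: "invertible P" "V = conj_mat P ` T1"
    unfolding similar_subspaces_iff_conj_mat by blast
  then obtain M where M: "M \<in> T1" "?E = conj_mat P M"
    using assms by blast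
  have "conj_mat P (M ** M) = 0"
    unfolding conj_mat_mult[OF P(1)] M(2)[symmetric] by simp
  then have "M = 0"
    using T1_no_square_zero[OF M(1)] conj_mat_eq_0_iff[OF P(1)] by blast
  then have "?E = 0" using M(2) by (simp add: conj_mat_def)
  then show False by simp
qed

text \<open>
  The trace is a similarity invariant; it vanishes on \<open>T3\<close> and not on \<open>T2\<close>.
\<close>

lemma T2_not_similar_T3: "\<not> similar_subspaces T2 T3"
proof
  let ?J = "mat3 1 0 1 1 1 0 0 1 (1::bit)"
  assume "similar_subspaces T2 T3"
  then obtain P where P: "invertible P" "T3 = conj_mat P ` T2"
    unfolding similar_subspaces_iff_conj_mat by blast
  have "?J \<in> T2" by (simp add: T_elements)
  then have "conj_mat P ?J \<in> T3" using P(2) by blast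
  then have "trace (conj_mat P ?J) = 0" by (auto simp: T3_eq)
  then show False by (simp add: trace_conj_mat[OF P(1)])
qed

theorem theorem5p4:
  shows "(\<forall>T\<in>{T1, T2, T3}. irreducible_trivial_spectrum_3dim T)
    \<and> \<not> similar_subspaces T1 T2
    \<and> \<not> similar_subspaces T1 T3
    \<and> \<not> similar_subspaces T2 T3
    \<and> (\<forall>V. irreducible_trivial_spectrum_3dim V \<longrightarrow>
          similar_subspaces V T1 \<or> similar_subspaces V T2 \<or> similar_subspaces V T3)"
proof (intro conjI ballI allI impI)
  show "irreducible_trivial_spectrum_3dim T" if "T \<in> {T1, T2, T3}" for T
    using that by (rule T_irreducible_trivial_spectrum)
  show "\<not> similar_subspaces T1 T2" "\<not> similar_subspaces T1 T3"
    by (rule T1_not_similar, simp add: T_elements)+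
  show "\<not> similar_subspaces T2 T3" by (rule T2_not_similar_T3)
  show "similar_subspaces V T1 \<or> similar_subspaces V T2 \<or> similar_subspaces V T3"
    if "irreducible_trivial_spectrum_3dim V" for V
    using classification irreducible_trivial_spectrum_3dim_imp_admissible[OF that] by blast
qed

end
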